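(* For any metric spaces $X_1$, $X_2$ we have $$\operatorname{hypdim}(X_1\times X_2)\le\operatorname{hypdim}X_1+\operatorname{hypdim}X_2 .$$
   Context: $X_1\times X_2$ carries the $\ell^2$ product metric. Boundedness: let $\mathcal N$ be the set of functions $N:(0,1)\to\mathbb N$ and $\mathcal R$ the set of functions $R:(0,1)\to[0,\infty)$. A metric space $A$ (in particular a subset of a metric space, with the induced metric) is $(N,R)$-bounded if for every $\rho\in(0,1)$ every ball of radius $r\ge R(\rho)$ in $A$ contains at most $N(\rho)$ points which are $\rho r$-separated (pairwise distances $\ge\rho r$). It is $N$-bounded if it is $(N,R)$-bounded for some $R\in\mathcal R$. Uniformly $N$-bounded coverings: given $N\in\mathcal N$, a covering $\mathcal U$ of a metric space $X$ is uniformly $N$-bounded if (i) there is $R\in\mathcal R$ such that every element of $\mathcal U$ is $(N,R)$-bounded, and (ii) any finite union of elements of $\mathcal U$ is $N$-bounded. Lebesgue number: $L(\mathcal U)=\inf_{x\in X}\max\{\operatorname{dist}(x,X\setminus U): U\in\mathcal U\}$ (with $\operatorname{dist}(x,\emptyset)=\infty$). Hyperbolic dimension: $\operatorname{hypdim}X$ is the minimal integer $n\ge 0$ (or $\infty$ if there is none) such that for every $d>0$ there are a function $N\in\mathcal N$ and a uniformly $N$-bounded covering $\mathcal U$ of $X$ with $L(\mathcal U)\ge d$ and multiplicity $\le n+1$ (every point lies in at most $n+1$ elements). *)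

theory Defs
  imports "HOL-Analysis.Analysis"
begin

text \<open>
  Metric spaces are the library's abstract ones, so the carrier may be empty and a subset with its
  induced metric is \<^const>\<open>submetric\<close>; \<^const>\<open>prod_metric\<close> is the \<open>\<ell>\<^sup>2\<close> product
  metric. Control functions on the open unit interval are total functions on the reals of which
  only the values on \<open>{0<..<1}\<close> are ever used.
\<close>

definition separated_in :: "'a metric \<Rightarrow> real \<Rightarrow> 'a set \<Rightarrow> bool" where
  "separated_in A s S \<longleftrightarrow> S \<subseteq> mspace A \<and> (\<forall>x\<in>S. \<forall>y\<in>S. x \<noteq> y \<longrightarrow> s \<le> mdist A x y)"

definition control_radius :: "(real \<Rightarrow> real) \<Rightarrow> bool" where
  "control_radius R \<longleftrightarrow> (\<forall>\<rho>\<in>{0<..<1}. 0 \<le> R \<rho>)"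

text \<open>Balls are open, with centre in the space \<open>A\<close> itself.\<close>

definition NR_bounded :: "(real \<Rightarrow> nat) \<Rightarrow> (real \<Rightarrow> real) \<Rightarrow> 'a metric \<Rightarrow> bool" where
  "NR_bounded N R A \<longleftrightarrow>
     (\<forall>\<rho>\<in>{0<..<1}. \<forall>x\<in>mspace A. \<forall>r\<ge>R \<rho>. \<forall>S\<subseteq>mball_of A x r.
        separated_in A (\<rho> * r) S \<longrightarrow> finite S \<and> card S \<le> N \<rho>)"

definition N_bounded :: "(real \<Rightarrow> nat) \<Rightarrow> 'a metric \<Rightarrow> bool" where
  "N_bounded N A \<longleftrightarrow> (\<exists>R. control_radius R \<and> NR_bounded N R A)"

definition covering :: "'a metric \<Rightarrow> 'a set set \<Rightarrow> bool" where
  "covering X \<U> \<longleftrightarrow> \<Union>\<U> = mspace X"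

definition uniformly_N_bounded_covering ::
    "(real \<Rightarrow> nat) \<Rightarrow> 'a metric \<Rightarrow> 'a set set \<Rightarrow> bool" where
  "uniformly_N_bounded_covering N X \<U> \<longleftrightarrow>
     covering X \<U> \<and>
     (\<exists>R. control_radius R \<and> (\<forall>U\<in>\<U>. NR_bounded N R (submetric X U))) \<and>
     (\<forall>\<F>\<subseteq>\<U>. finite \<F> \<longrightarrow> N_bounded N (submetric X (\<Union>\<F>)))"

text \<open>Valued in \<^typ>\<open>ennreal\<close>, so that the distance to the empty set is \<open>\<infinity>\<close>; the library's
  \<^const>\<open>infdist\<close> would give \<open>0\<close>.\<close>

definition dist_to :: "'a metric \<Rightarrow> 'a \<Rightarrow> 'a set \<Rightarrow> ennreal" where
  "dist_to X x B = (INF y\<in>B. ennreal (mdist X x y))"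

text \<open>The supremum is a maximum whenever \<open>x\<close> lies in only finitely many members of \<open>\<U>\<close>, since the
  distance vanishes for every \<open>U\<close> not containing \<open>x\<close>.\<close>

definition Lebesgue_number :: "'a metric \<Rightarrow> 'a set set \<Rightarrow> ennreal" where
  "Lebesgue_number X \<U> = (INF x\<in>mspace X. SUP U\<in>\<U>. dist_to X x (mspace X - U))"

definition multiplicity_le :: "'a metric \<Rightarrow> 'a set set \<Rightarrow> nat \<Rightarrow> bool" where
  "multiplicity_le X \<U> m \<longleftrightarrow>
     (\<forall>x\<in>mspace X. finite {U\<in>\<U>. x \<in> U} \<and> card {U\<in>\<U>. x \<in> U} \<le> m)"

text \<open>The infimum of a nonempty set of extended naturals is attained, and that of the empty set is
  \<open>\<infinity>\<close>.\<close>

definition hypdim :: "'a metric \<Rightarrow> enat" where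
  "hypdim X = Inf {enat n | n. \<forall>d>0::real. \<exists>N \<U>.
     uniformly_N_bounded_covering N X \<U> \<and>
     ennreal d \<le> Lebesgue_number X \<U> \<and> multiplicity_le X \<U> (n + 1)}"

end

theory Submission
  imports Defs
begin

text \<open>
  For a cover \<open>\<U>\<close> of \<open>X\<^sub>1\<close> of large Lebesgue number, cap \<open>dist x (X\<^sub>1 - u)\<close> at \<open>D\<close>, well-order
  \<open>\<U>\<close>, and call \<open>u\<close> leading at \<open>x\<close> at level \<open>c\<close> if it is the first member whose capped distance is
  at least \<open>c\<close>. For each \<open>x\<close> this divides the interval of levels from \<open>0\<close> to \<open>D\<close> into at most
  \<open>n\<^sub>1 + 1\<close> pieces, and similarly for a cover of \<open>X\<^sub>2\<close> into at most \<open>n\<^sub>2 + 1\<close>. Let the set \<open>W u v\<close>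
  consist of the \<open>(x, y)\<close> for which \<open>u\<close> leads at \<open>x\<close> and \<open>v\<close> leads at \<open>y\<close> at a common level. The
  common refinement of the two divisions has at most \<open>n\<^sub>1 + n\<^sub>2 + 1\<close> pieces, which bounds the
  multiplicity; one of these pieces has length at least \<open>D / (n\<^sub>1 + n\<^sub>2 + 1)\<close>, and its middle
  level survives moving \<open>(x, y)\<close> by half that length, which bounds the Lebesgue number. (These sets
  are the open stars of the staircase triangulation of the product of the two nerves.) Since \<open>W u v\<close>
  lies in \<open>u \<times> v\<close>, boundedness is inherited from products.
\<close>

subsection \<open>Boundedness of subspaces and products\<close>

lemma NR_bounded_subset:
  assumes "NR_bounded N R (submetric X B)" and "A \<subseteq> B"
  shows "NR_bounded N R (submetric X A)"
  unfolding NR_bounded_def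
proof (intro ballI allI impI)
  fix \<rho> x r S
  assume h: "\<rho> \<in> {0<..<1}" "x \<in> mspace (submetric X A)" "R \<rho> \<le> r"
    "S \<subseteq> mball_of (submetric X A) x r" "separated_in (submetric X A) (\<rho> * r) S"
  have "x \<in> mspace (submetric X B)" "separated_in (submetric X B) (\<rho> * r) S"
    using h(2,5) \<open>A \<subseteq> B\<close> unfolding separated_in_def by auto
  moreover have "mball_of (submetric X A) x r \<subseteq> mball_of (submetric X B) x r"
    using \<open>A \<subseteq> B\<close> by auto
  ultimately show "finite S \<and> card S \<le> N \<rho>"
    using assms(1) h(1,3,4) unfolding NR_bounded_def by blast
qed

text \<open>A separated subset of the ball of largest cardinality, which exists because
  cardinalities are bounded by \<open>N \<rho>\<close>, is a net: a point far from all of it could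
  be added. Positivity of \<open>r\<close> ensures that such a point is new.\<close>

lemma NR_bounded_net:
  assumes "NR_bounded N R A" and "\<rho> \<in> {0<..<1}" and "x \<in> mspace A" and "R \<rho> \<le> r" and "0 < r"
  obtains T where "T \<subseteq> mspace A" "finite T" "card T \<le> N \<rho>"
    "\<And>z. z \<in> mball_of A x r \<Longrightarrow> \<exists>t\<in>T. mdist A z t < \<rho> * r"
proof -
  define P where "P T \<longleftrightarrow> T \<subseteq> mball_of A x r \<and> separated_in A (\<rho> * r) T" for T
  have bd: "finite T \<and> card T \<le> N \<rho>" if "P T" for T
    using that assms(1-4) unfolding P_def NR_bounded_def by blast
  have "P {}" by (auto simp: P_def separated_in_def)
  have "\<forall>T. P T \<longrightarrow> card T < Suc (N \<rho>)" using bd by (simp add: less_Suc_eq_le)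
  from ex_has_greatest_nat[OF \<open>P {}\<close> this]
  obtain T where T: "P T" and mx: "\<And>T'. P T' \<Longrightarrow> card T' \<le> card T"
    by (elim exE conjE) simp
  have "\<exists>t\<in>T. mdist A z t < \<rho> * r" if z: "z \<in> mball_of A x r" for z
  proof (rule ccontr)
    assume "\<not> ?thesis"
    then have far: "\<And>t. t \<in> T \<Longrightarrow> \<rho> * r \<le> mdist A z t" by force
    have "0 < \<rho> * r" using assms by simp
    moreover have "mdist A z z = 0" using z by simp
    ultimately have "z \<notin> T" using far[of z] by auto
    have "P (insert z T)"
      using T z far unfolding P_def separated_in_def
      by (auto simp: mdist_commute)
    from mx[OF this] show False using \<open>z \<notin> T\<close> bd[OF T] by simp
  qed
  moreover have "T \<subseteq> mspace A" using T by (auto simp: P_def separated_in_def)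
  ultimately show thesis using that[of T] bd[OF T] by simp
qed

lemma mdist_prod_le_add:
  "mdist (prod_metric X Y) (x, y) (x', y') \<le> mdist X x x' + mdist Y y y'"
  by (simp add: prod_dist_def sqrt_sum_squares_le_sum)

lemma mdist_le_mdist_prod:
  "mdist X x x' \<le> mdist (prod_metric X Y) (x, y) (x', y')"
  "mdist Y y y' \<le> mdist (prod_metric X Y) (x, y) (x', y')"
  by (simp_all add: prod_dist_def)

text \<open>The factor balls of the same radius \<open>r\<close> have
  \<open>\<rho>/4 * r\<close>-nets. Two points of \<open>S\<close> assigned to the same pair of net
  points differ by less than \<open>\<rho> * r / 2\<close> in each coordinate, hence by less than
  \<open>\<rho> * r\<close> in the product. So the assignment is injective, and the net pairs bound
  the cardinality.\<close>

lemma NR_bounded_prod: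
  assumes A: "NR_bounded N1 R1 A" and B: "NR_bounded N2 R2 B"
  shows "NR_bounded (\<lambda>\<rho>. N1 (\<rho>/4) * N2 (\<rho>/4)) (\<lambda>\<rho>. max (R1 (\<rho>/4)) (R2 (\<rho>/4))) (prod_metric A B)"
  unfolding NR_bounded_def
proof (intro ballI allI impI)
  fix \<rho> p r S
  assume \<rho>: "\<rho> \<in> {0<..<1}" and p: "p \<in> mspace (prod_metric A B)"
    and r: "max (R1 (\<rho>/4)) (R2 (\<rho>/4)) \<le> r"
    and S: "S \<subseteq> mball_of (prod_metric A B) p r"
    and sep: "separated_in (prod_metric A B) (\<rho> * r) S"
  obtain x y where xy: "p = (x, y)" "x \<in> mspace A" "y \<in> mspace B" using p by auto
  show "finite S \<and> card S \<le> N1 (\<rho>/4) * N2 (\<rho>/4)"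
  proof (cases "0 < r")
    case False
    \<comment> \<open>Nothing forces the control radii to be positive, so \<open>r\<close> may be
      zero or negative; the open ball is then empty.\<close>
    have "S = {}"
    proof (rule equals0I)
      fix z assume "z \<in> S"
      then have "mdist (prod_metric A B) p z < r"
        using S by (simp only: subset_iff in_mball_of)
      then show False using False mdist_nonneg[of "prod_metric A B" p z] by linarith
    qed
    then show ?thesis by simp
  next
    case True
    have \<rho>4: "\<rho>/4 \<in> {0<..<1}" using \<rho> by auto
    obtain T1 where T1: "finite T1" "card T1 \<le> N1 (\<rho>/4)" "T1 \<subseteq> mspace A"
      "\<And>z. z \<in> mball_of A x r \<Longrightarrow> \<exists>t\<in>T1. mdist A z t < \<rho>/4 * r"
      using NR_bounded_net[OF A \<rho>4 xy(2) _ True] r by (metis max.bounded_iff)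
    obtain T2 where T2: "finite T2" "card T2 \<le> N2 (\<rho>/4)" "T2 \<subseteq> mspace B"
      "\<And>z. z \<in> mball_of B y r \<Longrightarrow> \<exists>t\<in>T2. mdist B z t < \<rho>/4 * r"
      using NR_bounded_net[OF B \<rho>4 xy(3) _ True] r by (metis max.bounded_iff)
    have "\<exists>t. t \<in> T1 \<times> T2 \<and> mdist A (fst z) (fst t) < \<rho>/4 * r \<and> mdist B (snd z) (snd t) < \<rho>/4 * r"
      if z: "z \<in> S" for z
    proof -
      obtain a b where ab: "z = (a, b)" by force
      have zm: "a \<in> mspace A" "b \<in> mspace B" "mdist (prod_metric A B) (x, y) (a, b) < r"
        using z S unfolding ab xy by auto
      have "a \<in> mball_of A x r" "b \<in> mball_of B y r"
        using zm xy mdist_le_mdist_prod(1)[of A x a B y b] mdist_le_mdist_prod(2)[of B y b A x a]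
        by (simp_all del: mdist_prod_metric)
      from T1(4)[OF this(1)] T2(4)[OF this(2)] show ?thesis
        using ab by fastforce
    qed
    then obtain f where f: "\<And>z. z \<in> S \<Longrightarrow> f z \<in> T1 \<times> T2"
      "\<And>z. z \<in> S \<Longrightarrow> mdist A (fst z) (fst (f z)) < \<rho>/4 * r"
      "\<And>z. z \<in> S \<Longrightarrow> mdist B (snd z) (snd (f z)) < \<rho>/4 * r"
      by metis
    have "inj_on f S"
    proof (rule inj_onI, rule ccontr)
      fix z w assume zw: "z \<in> S" "w \<in> S" "f z = f w" "z \<noteq> w"
      obtain a b c d where ab: "z = (a, b)" "w = (c, d)" by (metis surj_pair)
      obtain s t where st: "f z = (s, t)" by force
      have m: "a \<in> mspace A" "c \<in> mspace A" "b \<in> mspace B" "d \<in> mspace B"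
        using zw S ab by auto
      have sm: "s \<in> mspace A" "t \<in> mspace B" using f(1)[OF zw(1)] st T1 T2 by auto
      have 1: "mdist A a c \<le> mdist A a s + mdist A c s"
        using mdist_triangle[OF m(1) sm(1) m(2)] by (simp add: mdist_commute)
      have 2: "mdist B b d \<le> mdist B b t + mdist B d t"
        using mdist_triangle[OF m(3) sm(2) m(4)] by (simp add: mdist_commute)
      have "\<rho> * r \<le> mdist (prod_metric A B) z w"
        using sep zw unfolding separated_in_def by blast
      also have "\<dots> \<le> mdist A a c + mdist B b d" unfolding ab by (rule mdist_prod_le_add)
      also have "\<dots> < \<rho> * r"
        using 1 2 f(2,3)[OF zw(1)] f(2,3)[OF zw(2)] zw(3)[symmetric] st ab by simp
      finally show False by simp
    qed
    moreover have "f ` S \<subseteq> T1 \<times> T2" using f(1) by blast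
    moreover have "finite (T1 \<times> T2)" using T1(1) T2(1) by simp
    ultimately have "finite S" "card S \<le> card (T1 \<times> T2)"
      by (rule inj_on_finite, rule card_inj_on_le)
    moreover have "card (T1 \<times> T2) \<le> N1 (\<rho>/4) * N2 (\<rho>/4)"
      by (simp add: card_cartesian_product mult_le_mono T1 T2)
    ultimately show ?thesis by linarith
  qed
qed

lemma NR_bounded_subset_prod:
  assumes "NR_bounded N1 R1 (submetric X A)" and "NR_bounded N2 R2 (submetric Y B)"
    and "W \<subseteq> A \<times> B"
  shows "NR_bounded (\<lambda>\<rho>. N1 (\<rho>/4) * N2 (\<rho>/4)) (\<lambda>\<rho>. max (R1 (\<rho>/4)) (R2 (\<rho>/4)))
    (submetric (prod_metric X Y) W)"
  by (rule NR_bounded_subset[OF _ assms(3)])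
    (simp add: submetric_prod_metric NR_bounded_prod assms)

lemma control_radius_prod:
  assumes "control_radius R1"
  shows "control_radius (\<lambda>\<rho>. max (R1 (\<rho>/4)) (R2 (\<rho>/4)))"
  using assms by (simp add: control_radius_def le_max_iff_disj)

text \<open>Each member inherits its bound from a single box \<open>u \<times> v\<close>. A finite
  union lies in one box whose sides are finite unions of members of the two coverings, so the same
  control function serves, whatever the number of members.\<close>

lemma uniformly_N_bounded_covering_refine_prod:
  assumes U: "uniformly_N_bounded_covering N1 X \<U>" and V: "uniformly_N_bounded_covering N2 Y \<V>"
    and cov: "covering (prod_metric X Y) \<W>"
    and refine: "\<And>W. W \<in> \<W> \<Longrightarrow> \<exists>u\<in>\<U>. \<exists>v\<in>\<V>. W \<subseteq> u \<times> v"
  shows "uniformly_N_bounded_covering (\<lambda>\<rho>. N1 (\<rho>/4) * N2 (\<rho>/4)) (prod_metric X Y) \<W>"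
  unfolding uniformly_N_bounded_covering_def
proof (intro conjI cov allI impI)
  obtain R1 where R1: "control_radius R1" "\<And>u. u \<in> \<U> \<Longrightarrow> NR_bounded N1 R1 (submetric X u)"
    using U unfolding uniformly_N_bounded_covering_def by blast
  obtain R2 where R2: "\<And>v. v \<in> \<V> \<Longrightarrow> NR_bounded N2 R2 (submetric Y v)"
    using V unfolding uniformly_N_bounded_covering_def by blast
  show "\<exists>R. control_radius R \<and>
    (\<forall>W\<in>\<W>. NR_bounded (\<lambda>\<rho>. N1 (\<rho>/4) * N2 (\<rho>/4)) R (submetric (prod_metric X Y) W))"
    using control_radius_prod[OF R1(1), of R2] NR_bounded_subset_prod[OF R1(2) R2] refine by blast
next
  fix \<F> assume \<F>: "\<F> \<subseteq> \<W>" "finite \<F>"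
  obtain f g where fg: "\<And>W. W \<in> \<W> \<Longrightarrow> f W \<in> \<U> \<and> g W \<in> \<V> \<and> W \<subseteq> f W \<times> g W"
    using refine by metis
  have "f ` \<F> \<subseteq> \<U>" "g ` \<F> \<subseteq> \<V>" "finite (f ` \<F>)" "finite (g ` \<F>)" using fg \<F> by auto
  then have "N_bounded N1 (submetric X (\<Union>(f ` \<F>)))" "N_bounded N2 (submetric Y (\<Union>(g ` \<F>)))"
    using U V unfolding uniformly_N_bounded_covering_def by blast+
  then obtain R1 R2 where R: "control_radius R1" "NR_bounded N1 R1 (submetric X (\<Union>(f ` \<F>)))"
    "NR_bounded N2 R2 (submetric Y (\<Union>(g ` \<F>)))"
    unfolding N_bounded_def by blast
  have sub: "\<Union>\<F> \<subseteq> \<Union>(f ` \<F>) \<times> \<Union>(g ` \<F>)" using fg \<F> by fastforce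
  show "N_bounded (\<lambda>\<rho>. N1 (\<rho>/4) * N2 (\<rho>/4)) (submetric (prod_metric X Y) (\<Union>\<F>))"
    unfolding N_bounded_def
    by (intro exI conjI) (rule control_radius_prod[OF R(1)], rule NR_bounded_subset_prod[OF R(2,3) sub])
qed

subsection \<open>The first index reaching a level\<close>

definition leading :: "'i rel \<Rightarrow> 'i set \<Rightarrow> ('i \<Rightarrow> real) \<Rightarrow> real \<Rightarrow> 'i \<Rightarrow> bool" where
  "leading r I f c i \<longleftrightarrow> i \<in> I \<and> c \<le> f i \<and> (\<forall>j\<in>I. j \<noteq> i \<and> (j, i) \<in> r \<longrightarrow> f j < c)"

lemma leading_exists:
  assumes "Well_order r" and "Field r = UNIV" and "i \<in> I" and "c \<le> f i"
  shows "\<exists>j. leading r I f c j"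
proof -
  have wf: "wf (r - Id)" using assms(1) by (simp add: well_order_on_def)
  have "i \<in> {j \<in> I. c \<le> f j}" using assms by simp
  from wfE_min[OF wf this]
  obtain j where "j \<in> {j \<in> I. c \<le> f j}" "\<And>k. (k, j) \<in> r - Id \<Longrightarrow> k \<notin> {j \<in> I. c \<le> f j}"
    by (metis (no_types, lifting))
  then show ?thesis unfolding leading_def by (intro exI[of _ j]) force
qed

lemma leading_unique:
  assumes "Well_order r" and "Field r = UNIV" and "leading r I f c i" and "leading r I f c j"
  shows "i = j"
proof (rule ccontr)
  assume "i \<noteq> j"
  then have "(i, j) \<in> r \<or> (j, i) \<in> r"
    using assms(1,2) by (auto simp: well_order_on_def linear_order_on_def total_on_def)
  then show False using assms(3,4) \<open>i \<noteq> j\<close> unfolding leading_def by force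
qed

text \<open>Raising the level only removes competitors, so the levels at which \<open>i\<close>
  leads, if any, form an interval ending at \<open>f i\<close>.\<close>

lemma leading_raise:
  assumes "leading r I f c i" and "c \<le> c'" and "c' \<le> f i"
  shows "leading r I f c' i"
  using assms unfolding leading_def by (auto intro: less_le_trans)

text \<open>No value of \<open>f\<close> lies strictly between \<open>a\<close> and
  \<open>a + 2 * d\<close>. A change by less than \<open>d\<close> therefore carries no value across
  the middle level \<open>a + d\<close>: the indices where \<open>g\<close> reaches
  \<open>a + d\<close> are those where \<open>f\<close> reaches \<open>a + 2 * d\<close>, and they
  have the same first element.\<close>

lemma leading_perturb:
  assumes "leading r I f (a + 2 * d) i" and "\<And>j. j \<in> I \<Longrightarrow> f j \<le> a \<or> a + 2 * d \<le> f j"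
    and "\<And>j. j \<in> I \<Longrightarrow> \<bar>g j - f j\<bar> < d"
  shows "leading r I g (a + d) i"
  unfolding leading_def
proof (intro conjI ballI impI)
  show "i \<in> I" using assms(1) by (simp add: leading_def)
  then show "a + d \<le> g i" using assms(1) assms(3)[of i] by (auto simp: leading_def)
  fix j assume j: "j \<in> I" "j \<noteq> i \<and> (j, i) \<in> r"
  then have "f j < a + 2 * d" using assms(1) by (simp add: leading_def)
  then show "g j < a + d" using assms(2,3)[OF j(1)] by linarith
qed

text \<open>A pair is recovered from the last level at which it leads, which is a positive value of \<open>f\<close>
  or of \<open>g\<close>.\<close>

lemma card_leading_pairs:
  fixes f :: "'i \<Rightarrow> real" and g :: "'j \<Rightarrow> real"
  assumes r: "Well_order r" "Field r = UNIV" and s: "Well_order s" "Field s = UNIV"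
    and C: "finite C" "\<And>i. i \<in> I \<Longrightarrow> 0 < f i \<Longrightarrow> f i \<in> C" "\<And>j. j \<in> J \<Longrightarrow> 0 < g j \<Longrightarrow> g j \<in> C"
  defines "P \<equiv> {(i, j). \<exists>c>0. leading r I f c i \<and> leading s J g c j}"
  shows "finite P \<and> card P \<le> card C"
proof -
  define m where "m = (\<lambda>(i, j). min (f i) (g j))"
  have lead: "leading r I f (m p) (fst p) \<and> leading s J g (m p) (snd p) \<and> m p \<in> C"
    if "p \<in> P" for p
  proof -
    from that obtain i j c where p: "p = (i, j)" "c > 0" "leading r I f c i" "leading s J g c j"
      unfolding P_def by blast
    have "c \<le> f i" "c \<le> g j" "i \<in> I" "j \<in> J" using p by (auto simp: leading_def)
    then show ?thesis
      using p C(2)[of i] C(3)[of j] by (auto simp: m_def min_def intro: leading_raise)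
  qed
  have "inj_on m P"
  proof (rule inj_onI)
    fix p q assume "p \<in> P" "q \<in> P" "m p = m q"
    then show "p = q"
      using lead[of p] lead[of q] leading_unique[OF r] leading_unique[OF s]
      by (metis prod.collapse)
  qed
  moreover have "m ` P \<subseteq> C" using lead by blast
  ultimately show ?thesis using C(1) by (auto intro: inj_on_finite card_inj_on_le)
qed

text \<open>Pigeonhole: \<open>m\<close> consecutive pieces of length \<open>D / m\<close> fill the
  interval from \<open>0\<close> to \<open>D\<close>. The point \<open>D\<close> is the right end of
  the last piece, so only the at most \<open>m - 1\<close> other points of \<open>C\<close> can
  block a piece.\<close>

lemma finite_set_gap:
  fixes C :: "real set"
  assumes "finite C" and "D \<in> C" and "card C \<le> m" and "0 < D"
  obtains a where "0 \<le> a" "a + D / m \<le> D" "\<And>c. c \<in> C \<Longrightarrow> c \<le> a \<or> a + D / m \<le> c"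
proof -
  have "card C > 0" using assms by (auto simp: card_gt_0_iff)
  then have m: "m > 0" using assms by simp
  have eq: "real m * (D / m) = D" using m by simp
  \<comment> \<open>The index of the piece containing \<open>c\<close>. Negative values of
    \<open>c\<close> are also sent to \<open>0\<close>, which can only block a further piece and
    leaves the count valid.\<close>
  define q where "q = (\<lambda>c::real. nat \<lfloor>c * m / D\<rfloor>)"
  have "card (q ` (C - {D})) \<le> card (C - {D})" by (rule card_image_le) (simp add: assms)
  also have "\<dots> < m" using assms \<open>card C > 0\<close> by simp
  finally have "\<not> {..<m} \<subseteq> q ` (C - {D})"
    using card_mono[of "q ` (C - {D})" "{..<m}"] assms(1) by auto
  then obtain k where k: "k < m" "k \<notin> q ` (C - {D})" by blast
  define a where "a = k * (D / m)"
  have "real k + 1 \<le> real m" using k by linarith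
  then have top: "a + D / m \<le> D"
    using mult_right_mono[of "real k + 1" "real m" "D / m"] assms(4) eq
    unfolding a_def by (simp add: distrib_right add_divide_distrib)
  show thesis
  proof
    show "0 \<le> a" using assms by (simp add: a_def)
    show "a + D / m \<le> D" by fact
    fix c assume c: "c \<in> C"
    show "c \<le> a \<or> a + D / m \<le> c"
    proof (rule ccontr)
      assume "\<not> ?thesis"
      then have lt: "a < c" "c < a + D / m" by auto
      then have "c \<noteq> D" using top by auto
      have "real k \<le> c * m / D" "c * m / D < real k + 1"
        using lt assms(4) m by (auto simp: a_def field_simps)
      then have "q c = k" unfolding q_def by linarith
      then show False using k c \<open>c \<noteq> D\<close> by blast
    qed
  qed
qed

subsection \<open>Capped distance to the complement\<close>

text \<open>Inserting \<open>D\<close> caps the distance and also keeps the set nonempty, so that a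
  member containing the whole space gets depth \<open>D\<close>, in agreement with an infinite
  distance to the empty complement.\<close>

definition depth :: "'a metric \<Rightarrow> real \<Rightarrow> 'a \<Rightarrow> 'a set \<Rightarrow> real" where
  "depth X D x u = Inf (insert D (mdist X x ` (mspace X - u)))"

lemma depth_bdd_below: "bdd_below (insert D (mdist X x ` B))"
  by (rule bdd_belowI[of _ "min D 0"]) (auto simp: min_le_iff_disj)

lemma depth_le: "y \<in> mspace X - u \<Longrightarrow> depth X D x u \<le> mdist X x y"
  unfolding depth_def by (rule cInf_lower[OF _ depth_bdd_below]) simp

lemma depth_le_cap: "depth X D x u \<le> D"
  unfolding depth_def by (rule cInf_lower[OF _ depth_bdd_below]) simp

lemma le_depth:
  assumes "c \<le> D" and "\<And>y. y \<in> mspace X - u \<Longrightarrow> c \<le> mdist X x y"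
  shows "c \<le> depth X D x u"
  unfolding depth_def using assms by (intro cInf_greatest) auto

lemma depth_pos_imp_mem:
  assumes "x \<in> mspace X" and "0 < depth X D x u"
  shows "x \<in> u"
proof (rule ccontr)
  assume "x \<notin> u"
  then have "depth X D x u \<le> mdist X x x" using assms by (intro depth_le) simp
  also have "mdist X x x = 0" using assms by simp
  finally show False using assms by simp
qed

lemma depth_lipschitz:
  assumes x: "x \<in> mspace X" and y: "y \<in> mspace X"
  shows "\<bar>depth X D y u - depth X D x u\<bar> \<le> mdist X x y"
proof -
  have "depth X D x u - mdist X x y \<le> depth X D y u"
    if x: "x \<in> mspace X" and y: "y \<in> mspace X" for x y
  proof (rule le_depth)
    show "depth X D x u - mdist X x y \<le> D"
      using depth_le_cap[of X D x u] mdist_nonneg[of X x y] by linarith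
    fix z assume z: "z \<in> mspace X - u"
    show "depth X D x u - mdist X x y \<le> mdist X y z"
      using depth_le[OF z, of D x] mdist_triangle[of x X y z] x y z by auto
  qed
  from this[OF x y] this[OF y x] show ?thesis by (simp add: mdist_commute abs_le_iff)
qed

text \<open>The supremum over \<U> need not be attained, but the strict inequality yields a member
  whose distance exceeds \<open>D\<close>, and capping turns it into exactly
  \<open>D\<close>.\<close>

lemma depth_cap_attained:
  assumes "ennreal D < Lebesgue_number X \<U>" and "x \<in> mspace X"
  shows "\<exists>u\<in>\<U>. depth X D x u = D"
proof -
  have "ennreal D < (SUP u\<in>\<U>. dist_to X x (mspace X - u))"
    using assms less_le_trans INF_lower unfolding Lebesgue_number_def by metis
  then obtain u where u: "u \<in> \<U>" "ennreal D < dist_to X x (mspace X - u)"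
    by (auto simp: less_SUP_iff)
  have "D \<le> mdist X x y" if "y \<in> mspace X - u" for y
  proof -
    have "dist_to X x (mspace X - u) \<le> ennreal (mdist X x y)"
      unfolding dist_to_def using that by (rule INF_lower)
    with u(2) have "ennreal D < ennreal (mdist X x y)" by simp
    then show ?thesis by (metis ennreal_leI not_le less_imp_le)
  qed
  then have "D \<le> depth X D x u" by (intro le_depth) auto
  then show ?thesis using u(1) depth_le_cap[of X D x u] by force
qed

text \<open>Only members containing \<open>x\<close> have positive depth there, so their depths, at
  most \<open>m\<close> in number, serve as \<open>C\<close>. The cap is among them because it is
  attained and positive.\<close>

lemma depth_levels:
  assumes mult: "multiplicity_le X \<U> m" and "ennreal D < Lebesgue_number X \<U>" and "0 < D"
    and x: "x \<in> mspace X"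
  obtains C where "finite C" "card C \<le> m" "D \<in> C"
    "\<And>u. u \<in> \<U> \<Longrightarrow> 0 < depth X D x u \<Longrightarrow> depth X D x u \<in> C"
proof
  let ?C = "depth X D x ` {u \<in> \<U>. x \<in> u}"
  have fin: "finite {u \<in> \<U>. x \<in> u}" "card {u \<in> \<U>. x \<in> u} \<le> m"
    using mult x by (auto simp: multiplicity_le_def)
  show "finite ?C" using fin by simp
  show "card ?C \<le> m" using card_image_le[OF fin(1)] fin(2) le_trans by blast
  show pos: "depth X D x u \<in> ?C" if "u \<in> \<U>" "0 < depth X D x u" for u
    using that depth_pos_imp_mem[OF x] by blast
  obtain u where "u \<in> \<U>" "depth X D x u = D" using depth_cap_attained assms by metis
  then show "D \<in> ?C" using pos[of u] \<open>0 < D\<close> by auto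
qed

subsection \<open>The covering of the product\<close>

text \<open>The level is required to be positive because depth \<open>0\<close> also occurs at
  points outside a member; positive depth is what places the cell inside
  \<open>u \<times> v\<close>.\<close>

definition cell :: "'a metric \<Rightarrow> 'b metric \<Rightarrow> 'a set rel \<Rightarrow> 'b set rel \<Rightarrow> real \<Rightarrow>
    'a set set \<Rightarrow> 'b set set \<Rightarrow> 'a set \<Rightarrow> 'b set \<Rightarrow> ('a \<times> 'b) set" where
  "cell X Y r s D \<U> \<V> u v = {(x, y). x \<in> mspace X \<and> y \<in> mspace Y \<and>
     (\<exists>c>0. leading r \<U> (depth X D x) c u \<and> leading s \<V> (depth Y D y) c v)}"

lemma cell_subset: "cell X Y r s D \<U> \<V> u v \<subseteq> u \<times> v"
proof
  fix p assume "p \<in> cell X Y r s D \<U> \<V> u v"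
  then obtain x y c where p: "p = (x, y)" "x \<in> mspace X" "y \<in> mspace Y"
    and c: "0 < c" "c \<le> depth X D x u" "c \<le> depth Y D y v"
    unfolding cell_def leading_def by blast
  have "0 < depth X D x u" "0 < depth Y D y v" using c by linarith+
  then show "p \<in> u \<times> v" using p depth_pos_imp_mem[of x X D u] depth_pos_imp_mem[of y Y D v] by simp
qed

lemma exists_product_covering:
  fixes X :: "'a metric" and Y :: "'b metric" and d :: real
  assumes U: "multiplicity_le X \<U> (m + 1)"
    and V: "multiplicity_le Y \<V> (n + 1)"
    and d: "0 < d"
    and LU: "ennreal (2 * real (m + n + 1) * d) < Lebesgue_number X \<U>"
    and LV: "ennreal (2 * real (m + n + 1) * d) < Lebesgue_number Y \<V>"
  shows "\<exists>\<W>. covering (prod_metric X Y) \<W> \<and> (\<forall>W\<in>\<W>. \<exists>u\<in>\<U>. \<exists>v\<in>\<V>. W \<subseteq> u \<times> v) \<and>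
    ennreal d \<le> Lebesgue_number (prod_metric X Y) \<W> \<and>
    multiplicity_le (prod_metric X Y) \<W> (m + n + 1)"
proof -
  \<comment> \<open>Chosen so that a gap of length \<open>D / (m + n + 1)\<close> is
    \<open>2 * d\<close>, leaving room \<open>d\<close> on either side of its middle level.\<close>
  define D where "D = 2 * real (m + n + 1) * d"
  have "real (m + n + 1) \<noteq> 0" by simp
  then have D: "0 < D" "D / real (m + n + 1) = 2 * d"
    using d nonzero_divide_eq_eq[of "real (m + n + 1)" D "2 * d"] by (simp_all add: D_def)
  from well_ordering obtain r :: "'a set rel" where r: "Well_order r" "Field r = UNIV"
    by (elim exE conjE)
  from well_ordering obtain s :: "'b set rel" where s: "Well_order s" "Field s = UNIV"
    by (elim exE conjE)
  let ?W = "\<lambda>p. cell X Y r s D \<U> \<V> (fst p) (snd p)"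
  define \<W> where "\<W> = ?W ` (\<U> \<times> \<V>)"
  have levels: "\<exists>C. finite C \<and> card C \<le> m + n + 1 \<and> D \<in> C \<and>
      (\<forall>u\<in>\<U>. 0 < depth X D x u \<longrightarrow> depth X D x u \<in> C) \<and>
      (\<forall>v\<in>\<V>. 0 < depth Y D y v \<longrightarrow> depth Y D y v \<in> C)"
    if x: "x \<in> mspace X" and y: "y \<in> mspace Y" for x y
  proof -
    obtain A where A: "finite A" "card A \<le> m + 1" "D \<in> A"
      "\<And>u. u \<in> \<U> \<Longrightarrow> 0 < depth X D x u \<Longrightarrow> depth X D x u \<in> A"
      using depth_levels[OF U LU[folded D_def] D(1) x] by metis
    obtain B where B: "finite B" "card B \<le> n + 1" "D \<in> B"
      "\<And>v. v \<in> \<V> \<Longrightarrow> 0 < depth Y D y v \<Longrightarrow> depth Y D y v \<in> B"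
      using depth_levels[OF V LV[folded D_def] D(1) y] by metis
    \<comment> \<open>The common top level \<open>D\<close> is counted only once, whence \<open>m + n + 1\<close> and not \<open>m + n + 2\<close>.\<close>
    have "card (A \<inter> B) \<noteq> 0" using A B by auto
    then have "card (A \<union> B) \<le> m + n + 1"
      using card_Un_Int[OF A(1) B(1)] A(2) B(2) by linarith
    then show ?thesis using A B by (intro exI[of _ "A \<union> B"]) auto
  qed
  have leadX: "\<exists>u. leading r \<U> (depth X D x) c u" if "x \<in> mspace X" "c \<le> D" for x c
    using depth_cap_attained[OF LU[folded D_def] that(1)] leading_exists[OF r] that(2) by metis
  have leadY: "\<exists>v. leading s \<V> (depth Y D y) c v" if "y \<in> mspace Y" "c \<le> D" for y c
    using depth_cap_attained[OF LV[folded D_def] that(1)] leading_exists[OF s] that(2) by metis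

  have "covering (prod_metric X Y) \<W>"
    unfolding covering_def
  proof (intro equalityI subsetI)
    fix p assume "p \<in> \<Union>\<W>"
    then show "p \<in> mspace (prod_metric X Y)" by (auto simp: \<W>_def cell_def)
  next
    fix p assume "p \<in> mspace (prod_metric X Y)"
    then obtain x y where p: "p = (x, y)" "x \<in> mspace X" "y \<in> mspace Y" by auto
    obtain u v where uv: "leading r \<U> (depth X D x) D u" "leading s \<V> (depth Y D y) D v"
      using leadX[OF p(2)] leadY[OF p(3)] by blast
    then have "p \<in> ?W (u, v)" using p D by (auto simp: cell_def)
    moreover have "?W (u, v) \<in> \<W>"
      unfolding \<W>_def using uv by (intro imageI) (simp add: leading_def)
    ultimately show "p \<in> \<Union>\<W>" by (rule UnionI[rotated])
  qed
  moreover have "\<forall>W\<in>\<W>. \<exists>u\<in>\<U>. \<exists>v\<in>\<V>. W \<subseteq> u \<times> v"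
    unfolding \<W>_def
  proof
    fix W assume "W \<in> ?W ` (\<U> \<times> \<V>)"
    then obtain u v where "u \<in> \<U>" "v \<in> \<V>" "W = cell X Y r s D \<U> \<V> u v" by force
    then show "\<exists>u\<in>\<U>. \<exists>v\<in>\<V>. W \<subseteq> u \<times> v" using cell_subset by metis
  qed
  moreover have "ennreal d \<le> Lebesgue_number (prod_metric X Y) \<W>"
    unfolding Lebesgue_number_def
  proof (rule INF_greatest)
    fix p assume "p \<in> mspace (prod_metric X Y)"
    then obtain x y where p: "p = (x, y)" "x \<in> mspace X" "y \<in> mspace Y" by auto
    obtain C where C: "finite C" "card C \<le> m + n + 1" "D \<in> C"
      "\<And>u. u \<in> \<U> \<Longrightarrow> 0 < depth X D x u \<Longrightarrow> depth X D x u \<in> C"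
      "\<And>v. v \<in> \<V> \<Longrightarrow> 0 < depth Y D y v \<Longrightarrow> depth Y D y v \<in> C"
      using levels[OF p(2,3)] by blast
    obtain a where a: "0 \<le> a" "a + 2 * d \<le> D" "\<And>c. c \<in> C \<Longrightarrow> c \<le> a \<or> a + 2 * d \<le> c"
      using finite_set_gap[OF C(1,3,2) D(1)] unfolding D(2) by metis
    \<comment> \<open>\<open>C\<close> records only positive depths; the others lie below the gap
      because \<open>0 \<le> a\<close>.\<close>
    have gapX: "depth X D x u \<le> a \<or> a + 2 * d \<le> depth X D x u" if "u \<in> \<U>" for u
      using a(1) a(3)[of "depth X D x u"] C(4)[OF that] by linarith
    have gapY: "depth Y D y v \<le> a \<or> a + 2 * d \<le> depth Y D y v" if "v \<in> \<V>" for v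
      using a(1) a(3)[of "depth Y D y v"] C(5)[OF that] by linarith
    obtain u v where uv: "leading r \<U> (depth X D x) (a + 2 * d) u"
      "leading s \<V> (depth Y D y) (a + 2 * d) v"
      using leadX[OF p(2) a(2)] leadY[OF p(3) a(2)] by blast
    have near: "q \<in> ?W (u, v)"
      if q: "q \<in> mspace (prod_metric X Y)" "mdist (prod_metric X Y) p q < d" for q
    proof -
      obtain x' y' where q': "q = (x', y')" "x' \<in> mspace X" "y' \<in> mspace Y" using q by auto
      have dX: "mdist X x x' < d" and dY: "mdist Y y y' < d"
        using q(2) mdist_le_mdist_prod(1)[of X x x' Y y y'] mdist_le_mdist_prod(2)[of Y y y' X x x']
        unfolding p q' by linarith+
      have "leading r \<U> (depth X D x') (a + d) u"
        by (rule leading_perturb[OF uv(1) gapX])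
          (use depth_lipschitz[OF p(2) q'(2)] dX le_less_trans in blast)+
      moreover have "leading s \<V> (depth Y D y') (a + d) v"
        by (rule leading_perturb[OF uv(2) gapY])
          (use depth_lipschitz[OF p(3) q'(3)] dY le_less_trans in blast)+
      moreover have "a + d > 0" using a d by simp
      ultimately show ?thesis using q' by (auto simp: cell_def)
    qed
    have "?W (u, v) \<in> \<W>"
      unfolding \<W>_def using uv by (intro imageI) (simp add: leading_def)
    moreover have "ennreal d \<le> dist_to (prod_metric X Y) p (mspace (prod_metric X Y) - ?W (u, v))"
      unfolding dist_to_def
    proof (rule INF_greatest)
      fix q assume "q \<in> mspace (prod_metric X Y) - ?W (u, v)"
      then have "d \<le> mdist (prod_metric X Y) p q" using near[of q] by force
      then show "ennreal d \<le> ennreal (mdist (prod_metric X Y) p q)" by (rule ennreal_leI)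
    qed
    ultimately show "ennreal d \<le>
      (SUP W\<in>\<W>. dist_to (prod_metric X Y) p (mspace (prod_metric X Y) - W))"
      by (rule SUP_upper2)
  qed
  moreover have "multiplicity_le (prod_metric X Y) \<W> (m + n + 1)"
    unfolding multiplicity_le_def
  proof
    fix p assume "p \<in> mspace (prod_metric X Y)"
    then obtain x y where p: "p = (x, y)" "x \<in> mspace X" "y \<in> mspace Y" by auto
    obtain C where C: "finite C" "card C \<le> m + n + 1"
      "\<And>u. u \<in> \<U> \<Longrightarrow> 0 < depth X D x u \<Longrightarrow> depth X D x u \<in> C"
      "\<And>v. v \<in> \<V> \<Longrightarrow> 0 < depth Y D y v \<Longrightarrow> depth Y D y v \<in> C"
      using levels[OF p(2,3)] by blast
    define P where "P = {(u, v). \<exists>c>0. leading r \<U> (depth X D x) c u \<and> leading s \<V> (depth Y D y) c v}"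
    have P: "finite P" "card P \<le> card C"
      unfolding P_def using card_leading_pairs[OF r s C(1,3,4)] by simp_all
    \<comment> \<open>Different pairs may give the same cell, which can only lower the number of
      members through \<open>p\<close>; hence an inclusion in an image suffices.\<close>
    have sub: "{W \<in> \<W>. p \<in> W} \<subseteq> ?W ` P"
    proof
      fix W assume "W \<in> {W \<in> \<W>. p \<in> W}"
      then obtain w where "W = ?W w" "p \<in> ?W w" unfolding \<W>_def by force
      moreover from this have "w \<in> P" unfolding P_def p cell_def by auto
      ultimately show "W \<in> ?W ` P" by (intro image_eqI)
    qed
    have "card {W \<in> \<W>. p \<in> W} \<le> card P"
      using card_mono[OF finite_imageI[OF P(1)] sub] card_image_le[OF P(1)] le_trans by blast
    then show "finite {W \<in> \<W>. p \<in> W} \<and> card {W \<in> \<W>. p \<in> W} \<le> m + n + 1"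
      using finite_subset[OF sub] P C(2) by auto
  qed
  ultimately show ?thesis by blast
qed

section \<open>From coverings to the inequality of dimensions\<close>

definition hypdim_le :: "'a metric \<Rightarrow> nat \<Rightarrow> bool" where
  "hypdim_le X n \<longleftrightarrow> (\<forall>d>0::real. \<exists>N \<U>. uniformly_N_bounded_covering N X \<U> \<and>
     ennreal d \<le> Lebesgue_number X \<U> \<and> multiplicity_le X \<U> (n + 1))"

lemma hypdim_eq_Inf: "hypdim X = Inf {enat n | n. hypdim_le X n}"
  by (simp add: hypdim_def hypdim_le_def)

lemma hypdim_finiteE:
  assumes "hypdim X \<noteq> \<infinity>"
  obtains n where "hypdim X = enat n" "hypdim_le X n"
proof -
  have "{enat n | n. hypdim_le X n} \<noteq> {}"
    using assms unfolding hypdim_eq_Inf Inf_enat_def by metis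
  then have "hypdim X \<in> {enat n | n. hypdim_le X n}"
    unfolding hypdim_eq_Inf Inf_enat_def by (metis (no_types, lifting) LeastI_ex all_not_in_conv)
  then show thesis using that by blast
qed

lemma hypdim_le_prod:
  assumes "hypdim_le X m" and "hypdim_le Y n"
  shows "hypdim_le (prod_metric X Y) (m + n)"
  unfolding hypdim_le_def
proof (intro allI impI)
  fix d :: real assume d: "0 < d"
  define D where "D = 2 * real (m + n + 1) * d"
  have "0 < D" using d by (simp add: D_def)
  \<comment> \<open>The extra \<open>1\<close> turns the weak bound on the Lebesgue numbers into the
    strict bound needed for the cap \<open>D\<close> to be attained.\<close>
  then have D: "0 < D + 1" "ennreal D < ennreal (D + 1)" by (simp_all add: ennreal_lessI)
  from assms(1) D(1) obtain N1 \<U> where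
    U: "uniformly_N_bounded_covering N1 X \<U>" "ennreal (D + 1) \<le> Lebesgue_number X \<U>"
      "multiplicity_le X \<U> (m + 1)"
    unfolding hypdim_le_def by blast
  from assms(2) D(1) obtain N2 \<V> where
    V: "uniformly_N_bounded_covering N2 Y \<V>" "ennreal (D + 1) \<le> Lebesgue_number Y \<V>"
      "multiplicity_le Y \<V> (n + 1)"
    unfolding hypdim_le_def by blast
  note LU = less_le_trans[OF D(2) U(2)] and LV = less_le_trans[OF D(2) V(2)]
  obtain \<W> where W: "covering (prod_metric X Y) \<W>"
      "\<And>W. W \<in> \<W> \<Longrightarrow> \<exists>u\<in>\<U>. \<exists>v\<in>\<V>. W \<subseteq> u \<times> v"
      "ennreal d \<le> Lebesgue_number (prod_metric X Y) \<W>"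
      "multiplicity_le (prod_metric X Y) \<W> (m + n + 1)"
    using exists_product_covering[OF U(3) V(3) d LU[unfolded D_def] LV[unfolded D_def]]
    by metis
  then show "\<exists>N \<W>. uniformly_N_bounded_covering N (prod_metric X Y) \<W> \<and>
      ennreal d \<le> Lebesgue_number (prod_metric X Y) \<W> \<and>
      multiplicity_le (prod_metric X Y) \<W> (m + n + 1)"
    using uniformly_N_bounded_covering_refine_prod[OF U(1) V(1)] by blast
qed

theorem theorem4p6:
  fixes X\<^sub>1 :: "'a metric" and X\<^sub>2 :: "'b metric"
  shows "hypdim (prod_metric X\<^sub>1 X\<^sub>2) \<le> hypdim X\<^sub>1 + hypdim X\<^sub>2"
proof (cases "hypdim X\<^sub>1 = \<infinity> \<or> hypdim X\<^sub>2 = \<infinity>")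
  case True
  then show ?thesis by auto
next
  case False
  then obtain m n where m: "hypdim X\<^sub>1 = enat m" "hypdim_le X\<^sub>1 m"
    and n: "hypdim X\<^sub>2 = enat n" "hypdim_le X\<^sub>2 n"
    using hypdim_finiteE by metis
  have "hypdim (prod_metric X\<^sub>1 X\<^sub>2) \<le> enat (m + n)"
    unfolding hypdim_eq_Inf using hypdim_le_prod[OF m(2) n(2)] by (intro Inf_lower) blast
  then show ?thesis using m n by simp
qed

end
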